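(* Let $a_0,a_1,\alpha,\beta,u,v\in\mathbb{R}$ with $\alpha\beta\neq 0$, $uv\neq 0$ and $|a_0|+|a_1|\neq 0$, and let $(a_{n,k})_{0\le k\le n}$ be the binary binomial interpolated triangle with parameters $(a_0,a_1,\alpha,\beta;u,v)$ (so $a_{0,0}=a_0$, $a_{1,0}=a_1$). Let $\mathcal{A}=u\alpha+2v$ and $D=\sqrt{\alpha^2+4\beta}$. (1) If $D\ne0$, then, with $x_1=(\alpha+D)/2$ and $x_2=(\alpha-D)/2$, for all $n\ge 1$ and $0\le k\le n$, $$a_{n,k}= \frac{(vD+\alpha v-2\beta u)a_{n,0}+2\beta a_{n,1}}{2 vD}\left(\frac{\beta u-vx_2}{\beta}\right)^k + \frac{(vD-\alpha v +2\beta u)a_{n,0}-2\beta a_{n,1}}{2 vD}\left(\frac{\beta u-vx_1}{\beta}\right)^k,$$ where $$a_{n,0} = \frac{(D-\alpha)a_{0,0}+2a_{1,0}}{2D}x_1^n+ \frac{(D+\alpha)a_{0,0}-2a_{1,0}}{2D}x_2^n\quad(n\ge 0),$$ $$a_{n,1} = \frac{(D-\alpha)a_{0,0}+2a_{1,0}}{2D}x_1^{n-1}(ux_1+v)+ \frac{(D+\alpha)a_{0,0}-2a_{1,0}}{2D}x_2^{n-1}(ux_2+v)\quad(n\ge 1).$$ (2) If $D=0$ and $\mathcal{A}\ne0$, then for all $n\ge 1$ and $0\le k\le n$, $$a_{n,k}= \left( a_{n,0}+k\left(\frac{\alpha a_{n,1}}{\mathcal{A}} -a_{n,0} \right) \right)\left(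 \frac{\mathcal{A}}{\alpha}\right)^k,$$ where $$a_{n,0} = \left(a_{0,0}+n\frac{2a_{1,0}-\alpha a_{0,0}}{\alpha } \right) \left( \frac{\alpha}{2}\right)^n\quad(n\ge 0),$$ $$a_{n,1} = u\,a_{n,0}+v \left(a_{0,0}+(n-1)\frac{2a_{1,0}-\alpha a_{0,0}}{\alpha } \right) \left( \frac{\alpha}{2}\right)^{n-1}\quad(n\ge 1).$$ (3) If $D=0$ and $\mathcal{A}=0$, then $$a_{n,0} = \left(a_{0,0}+n\frac{2a_{1,0}-\alpha a_{0,0}}{\alpha } \right) \left( \frac{\alpha}{2}\right)^n\quad(n\ge 0),\qquad a_{n,1} = u\,\frac{2a_{1,0}-\alpha a_{0,0}}{\alpha }\left( \frac{\alpha}{2}\right)^{n}\quad(n\ge 1),$$ and $a_{n,k}=0$ for all $2\le k\le n$.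
   Context: The binary binomial interpolated triangle with parameters $(a_0,a_1,\alpha,\beta;u,v)$ is the array of real numbers $a_{n,k}$ ($0\le k\le n$) defined as follows. Its left diagonal is $a_{n,0}=a_n$, where $(a_n)_{n\ge0}$ has initial values $a_0,a_1$ and satisfies $a_n=\alpha a_{n-1}+\beta a_{n-2}$ for $n\ge 2$. The other entries are given by $a_{n,k}=u\,a_{n,k-1}+v\,a_{n-1,k-1}$ for $1\le k\le n$. The number $D$ denotes a square root of $\alpha^2+4\beta$, which is complex if $\alpha^2+4\beta<0$; the convention $z^0=1$ (also for $z=0$) is used. *)

theory Defs
  imports Complex_Main
begin

fun binary_seq :: "real \<Rightarrow> real \<Rightarrow> real \<Rightarrow> real \<Rightarrow> nat \<Rightarrow> real" where
  "binary_seq a0 a1 \<alpha> \<beta> 0 = a0"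
| "binary_seq a0 a1 \<alpha> \<beta> (Suc 0) = a1"
| "binary_seq a0 a1 \<alpha> \<beta> (Suc (Suc n)) =
     \<alpha> * binary_seq a0 a1 \<alpha> \<beta> (Suc n) + \<beta> * binary_seq a0 a1 \<alpha> \<beta> n"

text \<open>The entry in row \<open>n\<close> and position \<open>k\<close> of the binary binomial interpolated triangle.
  Only the entries with \<open>k \<le> n\<close> belong to the triangle; the value 0 outside is a dummy,
  which the recursion never reaches from inside the triangle.\<close>

fun interp_triangle ::
  "real \<Rightarrow> real \<Rightarrow> real \<Rightarrow> real \<Rightarrow> real \<Rightarrow> real \<Rightarrow> nat \<Rightarrow> nat \<Rightarrow> real" where
  "interp_triangle a0 a1 \<alpha> \<beta> u v n 0 = binary_seq a0 a1 \<alpha> \<beta> n"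
| "interp_triangle a0 a1 \<alpha> \<beta> u v n (Suc k) =
     (if Suc k \<le> n
      then u * interp_triangle a0 a1 \<alpha> \<beta> u v n k + v * interp_triangle a0 a1 \<alpha> \<beta> u v (n - 1) k
      else 0)"

end

theory Submission
  imports Defs
begin

text \<open>If \<open>x \<noteq> 0\<close>, the step \<open>a\<^bsub>n,k\<^esub> = u a\<^bsub>n,k-1\<^esub> + v a\<^bsub>n-1,k-1\<^esub>\<close> multiplies a column \<open>x\<^sup>n\<close> by \<open>u + v / x\<close>.
  For distinct roots \<open>x\<^sub>1, x\<^sub>2\<close> of \<open>x\<^sup>2 = \<alpha> x + \<beta>\<close> the left diagonal is \<open>P x\<^sub>1\<^sup>n + Q x\<^sub>2\<^sup>n\<close>, hence
  \<open>a\<^bsub>n,k\<^esub> = P x\<^sub>1\<^sup>n (u + v / x\<^sub>1)\<^sup>k + Q x\<^sub>2\<^sup>n (u + v / x\<^sub>2)\<^sup>k\<close>, and \<open>x\<^sub>1 x\<^sub>2 = -\<beta>\<close> gives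
  \<open>u + v / x\<^sub>1 = (\<beta> u - v x\<^sub>2) / \<beta>\<close>; solving the cases \<open>k = 0, 1\<close> for the two summands gives the
  coefficients in terms of \<open>a\<^bsub>n,0\<^esub>\<close> and \<open>a\<^bsub>n,1\<^esub>\<close>. For a double root \<open>x = \<alpha> / 2\<close> the diagonal is
  \<open>(c + n d) x\<^sup>n\<close>, and every step multiplies by \<open>\<A> / \<alpha> = u + v / x\<close> and shifts \<open>c\<close> by a constant,
  unless \<open>\<A> = 0\<close>, when the first step leaves \<open>u d x\<^sup>n\<close> and the second leaves 0.\<close>

text \<open>Powers of a root of the characteristic equation satisfy the recurrence, hence so does
  every linear combination; \<open>P\<close> and \<open>Q\<close> only have to fit the two initial
  values. The roots are complex because \<alpha>^2 + 4 * \<beta> may be negative.\<close>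

lemma binary_seq_distinct_roots:
  fixes x y P Q :: complex
  assumes "x ^ 2 = of_real \<alpha> * x + of_real \<beta>" "y ^ 2 = of_real \<alpha> * y + of_real \<beta>"
    and "P + Q = of_real a0" "P * x + Q * y = of_real a1"
  shows "of_real (binary_seq a0 a1 \<alpha> \<beta> n) = P * x ^ n + Q * y ^ n"
proof (induction n rule: induct_nat_012)
  case (ge2 n)
  have "P * x ^ Suc (Suc n) + Q * y ^ Suc (Suc n) = P * x ^ n * x ^ 2 + Q * y ^ n * y ^ 2"
    by (simp add: power2_eq_square)
  also have "\<dots> = of_real \<alpha> * (P * x ^ Suc n + Q * y ^ Suc n) + of_real \<beta> * (P * x ^ n + Q * y ^ n)"
    unfolding assms by (simp add: algebra_simps)
  finally show ?case
    using ge2 by simp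
qed (use assms in auto)

text \<open>With \<open>x = \<alpha> / 2\<close> the vanishing discriminant gives
  \<open>\<beta> = - (x * x)\<close>, so the characteristic polynomial is (t - x)^2 and a linear
  factor times \<open>x ^ n\<close> solves the recurrence.\<close>

lemma binary_seq_double_root:
  fixes \<alpha> \<beta> :: real
  assumes "\<alpha> \<noteq> 0" "\<alpha> ^ 2 + 4 * \<beta> = 0"
  shows "binary_seq a0 a1 \<alpha> \<beta> n = (a0 + real n * ((2 * a1 - \<alpha> * a0) / \<alpha>)) * (\<alpha> / 2) ^ n"
proof (induction n rule: induct_nat_012)
  case 1
  show ?case
    using assms by (simp add: field_simps)
next
  case (ge2 n)
  define x where "x = \<alpha> / 2"
  define d where "d = (2 * a1 - \<alpha> * a0) / \<alpha>"
  have "\<alpha> = 2 * x" "\<beta> = - (x * x)"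
    using assms(2) by (simp_all add: x_def power2_eq_square)
  then show ?case
    unfolding binary_seq.simps ge2 x_def[symmetric] d_def[symmetric] by (simp add: algebra_simps)
qed simp

lemma interp_triangle_two_powers:
  fixes x y P Q :: complex
  assumes "\<And>n. of_real (interp_triangle a0 a1 \<alpha> \<beta> u v n 0) = P * x ^ n + Q * y ^ n"
    and "x \<noteq> 0" "y \<noteq> 0" "k \<le> n"
  shows "of_real (interp_triangle a0 a1 \<alpha> \<beta> u v n k) =
    P * x ^ n * (of_real u + of_real v / x) ^ k + Q * y ^ n * (of_real u + of_real v / y) ^ k"
  using \<open>k \<le> n\<close>
proof (induction k arbitrary: n)
  case 0
  show ?case
    using assms(1)[of n] by simp
next
  case (Suc k)
  then obtain m where "n = Suc m" "k \<le> m"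
    by (auto dest: Suc_le_D)
  with Suc.IH[of n] Suc.IH[of m] \<open>x \<noteq> 0\<close> \<open>y \<noteq> 0\<close> show ?case
    by (simp add: field_simps)
qed

text \<open>A step turns a linear factor L(n) into u * L(n) + (v / x) * L(n - 1). As L(n - 1) = L(n)
  - d, this is y * L(n) - (v / x) * d, that is, y times L(n) - (v / (x * y)) * d.\<close>

lemma interp_triangle_linear_times_power:
  fixes x y :: real
  assumes "\<And>n. interp_triangle a0 a1 \<alpha> \<beta> u v n 0 = (c + real n * d) * x ^ n"
    and "x \<noteq> 0" "y = u + v / x" "y \<noteq> 0" "k \<le> n"
  shows "interp_triangle a0 a1 \<alpha> \<beta> u v n k = (c + (real n - real k * (v / (x * y))) * d) * x ^ n * y ^ k"
  using \<open>k \<le> n\<close>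
proof (induction k arbitrary: n)
  case 0
  show ?case
    using assms(1)[of n] by simp
next
  case (Suc k)
  then obtain m where n: "n = Suc m" "k \<le> m"
    by (auto dest: Suc_le_D)
  define w where "w = v / (x * y)"
  \<comment> \<open>Expressing \<open>u\<close> and \<open>v\<close> through \<open>w\<close>,
    \<open>x\<close>, \<open>y\<close> removes all quotients, so the step becomes a polynomial
    identity.\<close>
  have v: "v = w * x * y" and u: "u = y - w * y"
    using assms by (simp_all add: w_def)
  have "interp_triangle a0 a1 \<alpha> \<beta> u v n (Suc k) =
      u * ((c + (real n - real k * w) * d) * x ^ n * y ^ k)
      + v * ((c + (real m - real k * w) * d) * x ^ m * y ^ k)"
    using n Suc.IH[of n] Suc.IH[of m] by (simp add: w_def)
  also have "\<dots> = (c + (real n - real (Suc k) * w) * d) * x ^ n * y ^ Suc k"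
    unfolding u v n(1) by (simp add: algebra_simps)
  finally show ?case
    unfolding w_def .
qed

theorem theorem11:
  fixes a0 a1 \<alpha> \<beta> u v \<A> :: real
    and a :: "nat \<Rightarrow> nat \<Rightarrow> real"
    and D x1 x2 :: complex
  assumes "\<alpha> * \<beta> \<noteq> 0" and "u * v \<noteq> 0" and "\<bar>a0\<bar> + \<bar>a1\<bar> \<noteq> 0"
    and "a = interp_triangle a0 a1 \<alpha> \<beta> u v"
    and "\<A> = u * \<alpha> + 2 * v"
    and "D ^ 2 = complex_of_real (\<alpha> ^ 2 + 4 * \<beta>)"
    and "x1 = (complex_of_real \<alpha> + D) / 2"
    and "x2 = (complex_of_real \<alpha> - D) / 2"
  shows
    "(D \<noteq> 0 \<longrightarrow>
        (\<forall>n k. 1 \<le> n \<and> k \<le> n \<longrightarrow>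
           complex_of_real (a n k) =
             ((of_real v * D + of_real \<alpha> * of_real v - 2 * of_real \<beta> * of_real u) * of_real (a n 0)
                + 2 * of_real \<beta> * of_real (a n 1)) / (2 * of_real v * D)
               * ((of_real \<beta> * of_real u - of_real v * x2) / of_real \<beta>) ^ k
           + ((of_real v * D - of_real \<alpha> * of_real v + 2 * of_real \<beta> * of_real u) * of_real (a n 0)
                - 2 * of_real \<beta> * of_real (a n 1)) / (2 * of_real v * D)
               * ((of_real \<beta> * of_real u - of_real v * x1) / of_real \<beta>) ^ k)
      \<and> (\<forall>n. complex_of_real (a n 0) =
             ((D - of_real \<alpha>) * of_real (a 0 0) + 2 * of_real (a 1 0)) / (2 * D) * x1 ^ n
           + ((D + of_real \<alpha>) * of_real (a 0 0) - 2 * of_real (a 1 0)) / (2 * D) * x2 ^ n)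
      \<and> (\<forall>n\<ge>1. complex_of_real (a n 1) =
             ((D - of_real \<alpha>) * of_real (a 0 0) + 2 * of_real (a 1 0)) / (2 * D)
               * x1 ^ (n - 1) * (of_real u * x1 + of_real v)
           + ((D + of_real \<alpha>) * of_real (a 0 0) - 2 * of_real (a 1 0)) / (2 * D)
               * x2 ^ (n - 1) * (of_real u * x2 + of_real v)))
   \<and> (D = 0 \<and> \<A> \<noteq> 0 \<longrightarrow>
        (\<forall>n k. 1 \<le> n \<and> k \<le> n \<longrightarrow>
           a n k = (a n 0 + real k * (\<alpha> * a n 1 / \<A> - a n 0)) * (\<A> / \<alpha>) ^ k)
      \<and> (\<forall>n. a n 0 = (a 0 0 + real n * ((2 * a 1 0 - \<alpha> * a 0 0) / \<alpha>)) * (\<alpha> / 2) ^ n)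
      \<and> (\<forall>n\<ge>1. a n 1 = u * a n 0
           + v * (a 0 0 + (real n - 1) * ((2 * a 1 0 - \<alpha> * a 0 0) / \<alpha>)) * (\<alpha> / 2) ^ (n - 1)))
   \<and> (D = 0 \<and> \<A> = 0 \<longrightarrow>
        (\<forall>n. a n 0 = (a 0 0 + real n * ((2 * a 1 0 - \<alpha> * a 0 0) / \<alpha>)) * (\<alpha> / 2) ^ n)
      \<and> (\<forall>n\<ge>1. a n 1 = u * ((2 * a 1 0 - \<alpha> * a 0 0) / \<alpha>) * (\<alpha> / 2) ^ n)
      \<and> (\<forall>n k. 2 \<le> k \<and> k \<le> n \<longrightarrow> a n k = 0))"
proof -
  have nz: "\<alpha> \<noteq> 0" "\<beta> \<noteq> 0" "u \<noteq> 0" "v \<noteq> 0"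
    using assms(1,2) by auto
  have a_col0: "a n 0 = binary_seq a0 a1 \<alpha> \<beta> n" for n
    by (simp add: \<open>a = _\<close>)
  have a_00: "a 0 0 = a0" and a_10: "a 1 0 = a1"
    by (simp_all add: \<open>a = _\<close>)
  have a_step: "a n (Suc k) = u * a n k + v * a (n - 1) k" if "Suc k \<le> n" for n k
    using that by (simp add: \<open>a = _\<close>)
  have a_col1: "a n 1 = u * a n 0 + v * a (n - 1) 0" if "n \<ge> 1" for n
    using a_step[of 0 n] that by simp

  have distinct: "(\<forall>n k. 1 \<le> n \<and> k \<le> n \<longrightarrow>
           complex_of_real (a n k) =
             ((of_real v * D + of_real \<alpha> * of_real v - 2 * of_real \<beta> * of_real u) * of_real (a n 0)
                + 2 * of_real \<beta> * of_real (a n 1)) / (2 * of_real v * D)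
               * ((of_real \<beta> * of_real u - of_real v * x2) / of_real \<beta>) ^ k
           + ((of_real v * D - of_real \<alpha> * of_real v + 2 * of_real \<beta> * of_real u) * of_real (a n 0)
                - 2 * of_real \<beta> * of_real (a n 1)) / (2 * of_real v * D)
               * ((of_real \<beta> * of_real u - of_real v * x1) / of_real \<beta>) ^ k)
      \<and> (\<forall>n. complex_of_real (a n 0) =
             ((D - of_real \<alpha>) * of_real (a 0 0) + 2 * of_real (a 1 0)) / (2 * D) * x1 ^ n
           + ((D + of_real \<alpha>) * of_real (a 0 0) - 2 * of_real (a 1 0)) / (2 * D) * x2 ^ n)
      \<and> (\<forall>n\<ge>1. complex_of_real (a n 1) =
             ((D - of_real \<alpha>) * of_real (a 0 0) + 2 * of_real (a 1 0)) / (2 * D)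
               * x1 ^ (n - 1) * (of_real u * x1 + of_real v)
           + ((D + of_real \<alpha>) * of_real (a 0 0) - 2 * of_real (a 1 0)) / (2 * D)
               * x2 ^ (n - 1) * (of_real u * x2 + of_real v))" if D: "D \<noteq> 0"
  proof -
    define P where "P = ((D - of_real \<alpha>) * of_real (a 0 0) + 2 * of_real (a 1 0)) / (2 * D)"
    define Q where "Q = ((D + of_real \<alpha>) * of_real (a 0 0) - 2 * of_real (a 1 0)) / (2 * D)"
    have D2: "D * D = of_real \<alpha> * of_real \<alpha> + 4 * of_real \<beta>"
      using assms(6) by (simp add: power2_eq_square)
    have prod: "x1 * x2 = - of_real \<beta>"
      using D2 by (simp add: assms(7,8) field_simps)
    have x_nz: "x1 \<noteq> 0" "x2 \<noteq> 0"
      using prod nz by auto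
    have roots: "x1 ^ 2 = of_real \<alpha> * x1 + of_real \<beta>" "x2 ^ 2 = of_real \<alpha> * x2 + of_real \<beta>"
      using D2 by (simp_all add: assms(7,8) power2_eq_square field_simps)
    have "P + Q = of_real a0" "P * x1 + Q * x2 = of_real a1"
      unfolding P_def Q_def a_00 a_10 using D by (simp_all add: assms(7,8) field_simps)
    then have col0: "of_real (a n 0) = P * x1 ^ n + Q * x2 ^ n" for n
      unfolding a_col0 by (rule binary_seq_distinct_roots[OF roots])
    define y1 where "y1 = (of_real \<beta> * of_real u - of_real v * x2) / of_real \<beta>"
    define y2 where "y2 = (of_real \<beta> * of_real u - of_real v * x1) / of_real \<beta>"
    have \<beta>: "of_real \<beta> = - (x1 * x2)"
      using prod by simp
    have y: "of_real u + of_real v / x1 = y1" "of_real u + of_real v / x2 = y2"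
      using x_nz by (simp_all add: y1_def y2_def \<beta> field_simps)
    have entry: "of_real (a n k) = P * x1 ^ n * y1 ^ k + Q * x2 ^ n * y2 ^ k" if "k \<le> n" for n k
      using interp_triangle_two_powers[OF col0[unfolded \<open>a = _\<close>] x_nz that] by (simp add: \<open>a = _\<close> y)
    have diff: "D = x1 - x2" and sum: "of_real \<alpha> = x1 + x2"
      by (simp_all add: assms(7,8) field_simps)
    \<comment> \<open>The two summands solve the linear system given by columns 0 and 1, whose
      determinant is nonzero because y1 - y2 = v * D / \<beta>. The bound \<open>n \<ge> 1\<close>
      keeps \<open>a n 1\<close> inside the triangle.\<close>
    have coeffs:
      "((of_real v * D + of_real \<alpha> * of_real v - 2 * of_real \<beta> * of_real u) * of_real (a n 0)
          + 2 * of_real \<beta> * of_real (a n 1)) / (2 * of_real v * D) = P * x1 ^ n"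
      "((of_real v * D - of_real \<alpha> * of_real v + 2 * of_real \<beta> * of_real u) * of_real (a n 0)
          - 2 * of_real \<beta> * of_real (a n 1)) / (2 * of_real v * D) = Q * x2 ^ n"
      if "n \<ge> 1" for n
    proof -
      define p where "p = P * x1 ^ n"
      define q where "q = Q * x2 ^ n"
      have a: "of_real (a n 0) = p + q" "of_real (a n 1) = p * y1 + q * y2"
        using entry[of 0 n] entry[of 1 n] that by (simp_all add: p_def q_def)
      \<comment> \<open>Multiplying by \<beta> clears the denominators of \<open>y1\<close> and
        \<open>y2\<close>; with \<open>D = x1 - x2\<close> and \<alpha> = x1 + x2 the rest is
        polynomial.\<close>
      have "of_real \<beta> * y1 = of_real \<beta> * of_real u - of_real v * x2"
        "of_real \<beta> * y2 = of_real \<beta> * of_real u - of_real v * x1"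
        using nz by (simp_all add: y1_def y2_def)
      then have \<beta>1: "of_real \<beta> * of_real (a n 1) =
          p * (of_real \<beta> * of_real u - of_real v * x2) + q * (of_real \<beta> * of_real u - of_real v * x1)"
        unfolding a by (metis (no_types) distrib_left mult.left_commute)
      have "(of_real v * D + of_real \<alpha> * of_real v - 2 * of_real \<beta> * of_real u) * of_real (a n 0)
          + 2 * (of_real \<beta> * of_real (a n 1)) = p * (2 * of_real v * D)"
        "(of_real v * D - of_real \<alpha> * of_real v + 2 * of_real \<beta> * of_real u) * of_real (a n 0)
          - 2 * (of_real \<beta> * of_real (a n 1)) = q * (2 * of_real v * D)"
        unfolding \<beta>1 a(1) diff sum by (simp_all add: algebra_simps)
      with D nz show
        "((of_real v * D + of_real \<alpha> * of_real v - 2 * of_real \<beta> * of_real u) * of_real (a n 0)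
          + 2 * of_real \<beta> * of_real (a n 1)) / (2 * of_real v * D) = P * x1 ^ n"
        "((of_real v * D - of_real \<alpha> * of_real v + 2 * of_real \<beta> * of_real u) * of_real (a n 0)
          - 2 * of_real \<beta> * of_real (a n 1)) / (2 * of_real v * D) = Q * x2 ^ n"
        unfolding p_def[symmetric] q_def[symmetric] by (simp_all add: mult.assoc)
    qed
    have col1: "of_real (a n 1) = P * x1 ^ (n - 1) * (of_real u * x1 + of_real v)
        + Q * x2 ^ (n - 1) * (of_real u * x2 + of_real v)" if "n \<ge> 1" for n
    proof -
      obtain m where "n = Suc m"
        using \<open>n \<ge> 1\<close> by (cases n) auto
      then show ?thesis
        using a_col1[OF that] by (simp add: col0 algebra_simps)
    qed
    show ?thesis
      unfolding P_def[symmetric] Q_def[symmetric] y1_def[symmetric] y2_def[symmetric]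
      by (intro conjI allI impI; (elim conjE)?, (simp only: coeffs)?)
        (erule entry, rule col0, erule col1)
  qed

  define d where "d = (2 * a 1 0 - \<alpha> * a 0 0) / \<alpha>"
  have double_col0: "a n 0 = (a 0 0 + real n * d) * (\<alpha> / 2) ^ n" if "D = 0" for n
  proof -
    have "complex_of_real (\<alpha> ^ 2 + 4 * \<beta>) = 0"
      using assms(6) that by simp
    then have "\<alpha> ^ 2 + 4 * \<beta> = 0"
      by (simp only: of_real_eq_0_iff)
    then show ?thesis
      unfolding a_col0[of n] d_def a_00 a_10 using nz by (intro binary_seq_double_root)
  qed
  have double_entry: "a n k = (a n 0 + real k * (\<alpha> * a n 1 / \<A> - a n 0)) * (\<A> / \<alpha>) ^ k"
    if "D = 0" "\<A> \<noteq> 0" "1 \<le> n" "k \<le> n" for n k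
  proof -
    define x where "x = \<alpha> / 2"
    define y where "y = \<A> / \<alpha>"
    define w where "w = v / (x * y)"
    have xy: "x \<noteq> 0" "y = u + v / x" "y \<noteq> 0"
      using nz \<open>\<A> \<noteq> 0\<close> by (simp_all add: x_def y_def assms(5) field_simps)
    have entry: "a n k = (a 0 0 + (real n - real k * w) * d) * x ^ n * y ^ k" if "k \<le> n" for k
      using interp_triangle_linear_times_power[OF _ xy that] double_col0[OF \<open>D = 0\<close>]
      unfolding \<open>a = _\<close> x_def w_def by blast
    \<comment> \<open>Column 1 reveals the shift made by a single step: dividing by \<open>y\<close>
      and subtracting \<open>a n 0\<close> leaves \<open>- w * d * x ^ n\<close>, which column
      \<open>k\<close> contains \<open>k\<close> times.\<close>
    have "\<alpha> * a n 1 / \<A> = a n 1 / y"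
      by (simp add: y_def)
    also have "\<dots> = a n 0 - w * d * x ^ n"
      unfolding entry[of 0, OF le0] entry[of 1, OF \<open>1 \<le> n\<close>] using \<open>y \<noteq> 0\<close> by (simp add: field_simps)
    finally have ratio: "\<alpha> * a n 1 / \<A> = a n 0 - w * d * x ^ n" .
    show ?thesis
      unfolding y_def[symmetric] ratio entry[of 0, OF le0] entry[OF \<open>k \<le> n\<close>]
      by (simp add: algebra_simps)
  qed
  have double_col1: "a n 1 = u * a n 0 + v * (a 0 0 + (real n - 1) * d) * (\<alpha> / 2) ^ (n - 1)"
    if "D = 0" "n \<ge> 1" for n
    using a_col1[OF that(2)] double_col0[OF that(1), of "n - 1"] that(2) by (simp add: of_nat_diff)
  \<comment> \<open>Here v * (\<alpha> / 2)^(n - 1) = - u * (\<alpha> / 2)^n, so only the difference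
    \<open>d\<close> of consecutive linear factors survives.\<close>
  have zero_col1: "a n 1 = u * d * (\<alpha> / 2) ^ n" if "D = 0" "\<A> = 0" "n \<ge> 1" for n
  proof -
    have v: "v = - (u * (\<alpha> / 2))"
      using \<open>\<A> = 0\<close> assms(5) by (simp add: field_simps)
    obtain m where "n = Suc m"
      using \<open>n \<ge> 1\<close> by (cases n) auto
    then show ?thesis
      unfolding double_col1[OF \<open>D = 0\<close> \<open>n \<ge> 1\<close>] double_col0[OF \<open>D = 0\<close>, of n] v
      by (simp add: algebra_simps)
  qed
  have zero_entry: "a n k = 0" if "D = 0" "\<A> = 0" "2 \<le> k" "k \<le> n" for n k
    using that(3,4)
  proof (induction k arbitrary: n rule: dec_induct)
    case base
    have v: "v = - (u * (\<alpha> / 2))"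
      using \<open>\<A> = 0\<close> assms(5) by (simp add: field_simps)
    \<comment> \<open>Column 1 is geometric with ratio \<alpha> / 2, and
      \<open>v = - (u * (\<alpha> / 2))\<close> makes the next step cancel. Since
      \<open>m \<ge> 1\<close>, the formula for column 1 also covers row \<open>m\<close>.\<close>
    obtain m where "n = Suc m" "m \<ge> 1"
      using base by (cases n) auto
    then show ?case
      using a_step[of 1 n] zero_col1[OF that(1,2), of n] zero_col1[OF that(1,2), of m]
      by (simp add: v numeral_2_eq_2)
  next
    case (step k)
    then show ?case
      using a_step[of k n] by simp
  qed
  show ?thesis
    unfolding d_def[symmetric]
    using distinct double_col0 double_entry double_col1 zero_col1 zero_entry by blast
qed

end
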